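(* Let $X$ be a real Banach space with $\dim X\geqslant2$. If $$\lim_{t\to\frac12^{-}}\frac{2L_X(t)-1}{1-2t}=0,$$ then $X$ is uniformly smooth.
   Context: For $x,y$ in a real Banach space $X$, isosceles orthogonality $x\perp_I y$ means $\|x+y\|=\|x-y\|$. For $0\leqslant t<\frac12$ define $$L_X(t)=\sup\left\{\frac{\|tx+(1-t)y\|^2+\|(1-t)x+ty\|^2}{\|x+y\|^2}: x,y\in X,\ (x,y)\neq(0,0),\ x\perp_I y\right\}.$$ Let $S_X=\{x\in X:\|x\|=1\}$. The modulus of smoothness is $$\rho(t)=\sup\left\{\frac{\|x+ty\|+\|x-ty\|}{2}-1: x,y\in S_X\right\},$$ and $X$ is uniformly smooth if $\lim_{t\to0}\frac{\rho(t)}{t}=0$ (with $t>0$). *)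

theory Defs
  imports "HOL-Analysis.Analysis"
begin

definition isosceles_orthogonal :: "'a::real_normed_vector \<Rightarrow> 'a \<Rightarrow> bool"
    (infix "\<bottom>\<^sub>I" 50)
  where "x \<bottom>\<^sub>I y \<longleftrightarrow> norm (x + y) = norm (x - y)"

(* The space is passed as a type. The conditions on x and y give
   norm x <= norm (x + y), norm y <= norm (x + y) and norm (x + y) > 0, so for
   0 <= t <= 1 every quotient is at most 2; if the space is nonzero the set is
   nonempty (take y = 0), and the real-valued Sup is the true supremum. *)
definition L_const :: "'a::real_normed_vector itself \<Rightarrow> real \<Rightarrow> real"
  where "L_const _ t =
    Sup {((norm (t *\<^sub>R x + (1 - t) *\<^sub>R y))\<^sup>2 + (norm ((1 - t) *\<^sub>R x + t *\<^sub>R y))\<^sup>2)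
           / (norm (x + y))\<^sup>2 | x y :: 'a. (x, y) \<noteq> (0, 0) \<and> x \<bottom>\<^sub>I y}"

(* Every element of the set is at most \<bar>t\<bar>, and the unit sphere of a nonzero
   space is nonempty, so here too the real-valued Sup is the true supremum. *)
definition modulus_of_smoothness :: "'a::real_normed_vector itself \<Rightarrow> real \<Rightarrow> real"
  where "modulus_of_smoothness _ t =
    Sup {(norm (x + t *\<^sub>R y) + norm (x - t *\<^sub>R y)) / 2 - 1
           | x y :: 'a. x \<in> sphere 0 1 \<and> y \<in> sphere 0 1}"

definition uniformly_smooth :: "'a::real_normed_vector itself \<Rightarrow> bool"
  where "uniformly_smooth X \<longleftrightarrow>
    ((\<lambda>t. modulus_of_smoothness X t / t) \<longlongrightarrow> 0) (at_right 0)"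

(* The library's dim is 0 on infinite-dimensional spaces, which have to be
   admitted here. *)
definition dim_ge_2 :: "'a::real_vector itself \<Rightarrow> bool"
  where "dim_ge_2 _ \<longleftrightarrow> (\<exists>B :: 'a set. independent B \<and> card B = 2)"

end

theory Submission imports Defs
begin

text \<open>Put \<open>u = x + y\<close>, \<open>v = x - y\<close> and \<open>s = 1 - 2t\<close>. Then \<open>x\<close> and \<open>y\<close> are isosceles orthogonal
  iff \<open>u\<close> and \<open>v\<close> have the same norm, and the quotient in \<open>L(t)\<close> becomes
  \<open>(\<parallel>u + s v\<parallel>\<^sup>2 + \<parallel>u - s v\<parallel>\<^sup>2) / (4 \<parallel>u\<parallel>\<^sup>2)\<close>. For unit vectors \<open>u\<close>, \<open>v\<close> the mean of the squares
  dominates the square of the mean \<open>1 + r\<close>, and \<open>(1 + r)\<^sup>2 - 1 \<ge> 2 r\<close>; hence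
  \<open>2 \<rho>(s) \<le> 2 L(t) - 1\<close>.\<close>

text \<open>Since \<open>x\<close> and \<open>y\<close> are half the sum and half the difference of
  two vectors of norm \<open>?n\<close>, both lie in the ball of radius \<open>?n\<close> about 0.
  By convexity so do the two combinations, and each contributes at most 1 to the quotient.\<close>

lemma bdd_above_L_const_set:
  assumes "0 \<le> t" "t \<le> 1"
  shows "bdd_above {((norm (t *\<^sub>R x + (1 - t) *\<^sub>R y))\<^sup>2 + (norm ((1 - t) *\<^sub>R x + t *\<^sub>R y))\<^sup>2)
           / (norm (x + y))\<^sup>2 | x y :: 'a::real_normed_vector. (x, y) \<noteq> (0, 0) \<and> x \<bottom>\<^sub>I y}"
proof (rule bdd_aboveI[where M = 2], elim CollectE exE conjE, hypsubst)
  fix x y :: 'a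
  assume xy: "x \<bottom>\<^sub>I y"
  let ?n = "norm (x + y)"
  have eq: "norm (x - y) = ?n" using xy by (simp add: isosceles_orthogonal_def)
  have "norm (2 *\<^sub>R x) = norm ((x + y) + (x - y))" by (simp add: scaleR_2)
  also have "\<dots> \<le> ?n + ?n" using norm_triangle_ineq[of "x + y" "x - y"] eq by linarith
  finally have x: "norm x \<le> ?n" by simp
  have "norm (2 *\<^sub>R y) = norm ((x + y) - (x - y))" by (simp add: scaleR_2)
  also have "\<dots> \<le> ?n + ?n" using norm_triangle_ineq4[of "x + y" "x - y"] eq by linarith
  finally have y: "norm y \<le> ?n" by simp
  have "norm (a *\<^sub>R x + (1 - a) *\<^sub>R y) \<le> ?n" if "0 \<le> a" "a \<le> 1" for a
    using convexD[OF convex_cball, of x 0 ?n y a "1 - a"] x y that by simp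
  from this[of t] this[of "1 - t"]
  have "(norm (t *\<^sub>R x + (1 - t) *\<^sub>R y))\<^sup>2 \<le> ?n\<^sup>2" "(norm ((1 - t) *\<^sub>R x + t *\<^sub>R y))\<^sup>2 \<le> ?n\<^sup>2"
    using assms by (auto intro!: power_mono)
  then show "((norm (t *\<^sub>R x + (1 - t) *\<^sub>R y))\<^sup>2 + (norm ((1 - t) *\<^sub>R x + t *\<^sub>R y))\<^sup>2) / ?n\<^sup>2 \<le> 2"
    \<comment> \<open>For \<open>?n = 0\<close> the quotient is 0 by the convention for division by
      zero.\<close>
    by (cases "?n = 0") (simp_all add: divide_le_eq del: power_mono_iff)
qed

lemma L_const_ge:
  fixes u v :: "'a::real_normed_vector"
  assumes "norm u = 1" "norm v = 1" "0 \<le> t" "t \<le> 1"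
  shows "((norm (u - (1 - 2 * t) *\<^sub>R v))\<^sup>2 + (norm (u + (1 - 2 * t) *\<^sub>R v))\<^sup>2) / 4 \<le> L_const TYPE('a) t"
proof -
  \<comment> \<open>This inverts the substitution \<open>u = x + y\<close>,
    \<open>v = x - y\<close>.\<close>
  define x y where "x = (1/2) *\<^sub>R (u + v)" and "y = (1/2) *\<^sub>R (u - v)"
  have half: "(1/2) *\<^sub>R w + (1/2) *\<^sub>R w = w" for w :: 'a
    by (simp only: scaleR_left_distrib[symmetric]) simp
  have sum: "x + y = u" and diff: "x - y = v"
    unfolding x_def y_def scaleR_right_distrib scaleR_right_diff_distrib
    using half[of u] half[of v] by (simp_all add: algebra_simps)
  have "2 *\<^sub>R (t *\<^sub>R x + (1 - t) *\<^sub>R y) = (x + y) - (1 - 2 * t) *\<^sub>R (x - y)"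
    and "2 *\<^sub>R ((1 - t) *\<^sub>R x + t *\<^sub>R y) = (x + y) + (1 - 2 * t) *\<^sub>R (x - y)"
    by (simp_all add: algebra_simps scaleR_2)
  from this[THEN arg_cong[of _ _ norm]]
  have n1: "norm (t *\<^sub>R x + (1 - t) *\<^sub>R y) = norm (u - (1 - 2 * t) *\<^sub>R v) / 2"
    and n2: "norm ((1 - t) *\<^sub>R x + t *\<^sub>R y) = norm (u + (1 - 2 * t) *\<^sub>R v) / 2"
    unfolding sum diff by simp_all
  have "x \<bottom>\<^sub>I y" "(x, y) \<noteq> (0, 0)"
    using assms sum diff by (auto simp: isosceles_orthogonal_def)
  then have "((norm (t *\<^sub>R x + (1 - t) *\<^sub>R y))\<^sup>2 + (norm ((1 - t) *\<^sub>R x + t *\<^sub>R y))\<^sup>2)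
      / (norm (x + y))\<^sup>2 \<le> L_const TYPE('a) t"
    unfolding L_const_def by (intro cSup_upper bdd_above_L_const_set assms) blast
  then show ?thesis
    using assms by (simp add: n1 n2 sum power_divide add_divide_distrib)
qed

lemma mean_norm_le_L_const:
  fixes u v :: "'a::real_normed_vector"
  assumes "norm u = 1" "norm v = 1" "0 \<le> s" "s \<le> 1"
  shows "(norm (u + s *\<^sub>R v) + norm (u - s *\<^sub>R v)) / 2 - 1 \<le> (2 * L_const TYPE('a) ((1 - s) / 2) - 1) / 2"
proof -
  let ?a = "norm (u + s *\<^sub>R v)" and ?b = "norm (u - s *\<^sub>R v)"
  have s: "1 - 2 * ((1 - s) / 2) = s" by (simp add: field_simps)
  have "(?b\<^sup>2 + ?a\<^sup>2) / 4 \<le> L_const TYPE('a) ((1 - s) / 2)"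
    using L_const_ge[of u v "(1 - s) / 2", unfolded s] assms by simp
  \<comment> \<open>Expanded, this is
    \<open>?a\<^sup>2 + ?b\<^sup>2 \<ge> 2 * (?a + ?b) - 2\<close>; it replaces the passage through
    the square of the mean and leaves a linear estimate.\<close>
  moreover have "0 \<le> (?a - 1)\<^sup>2 + (?b - 1)\<^sup>2" by simp
  ultimately show ?thesis by (simp add: power2_eq_square algebra_simps)
qed

lemma modulus_of_smoothness_le_L_const:
  fixes e :: "'a::real_normed_vector"
  assumes e: "norm e = 1" and "0 \<le> s" "s \<le> 1"
  shows "modulus_of_smoothness TYPE('a) s \<le> (2 * L_const TYPE('a) ((1 - s) / 2) - 1) / 2"
  unfolding modulus_of_smoothness_def
proof (rule cSup_least)
  show "{(norm (x + s *\<^sub>R y) + norm (x - s *\<^sub>R y)) / 2 - 1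
      | x y :: 'a. x \<in> sphere 0 1 \<and> y \<in> sphere 0 1} \<noteq> {}"
    using e by auto
qed (use assms in \<open>auto intro!: mean_norm_le_L_const
      simp del: divide_le_eq_numeral1 le_divide_eq_numeral1\<close>)

text \<open>The choice \<open>x = y = e\<close> gives the value 0. This is the lower half of the
  final squeeze.\<close>

lemma modulus_of_smoothness_nonneg:
  fixes e :: "'a::real_normed_vector"
  assumes e: "norm e = 1" and s: "0 \<le> s" "s \<le> 1"
  shows "0 \<le> modulus_of_smoothness TYPE('a) s"
proof -
  have "norm (e + s *\<^sub>R e) = 1 + s" "norm (e - s *\<^sub>R e) = 1 - s"
    using e s norm_scaleR[of "1 + s" e] norm_scaleR[of "1 - s" e]
    by (simp_all add: algebra_simps)
  then have "0 = (norm (e + s *\<^sub>R e) + norm (e - s *\<^sub>R e)) / 2 - 1" by simp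
  also have "\<dots> \<le> modulus_of_smoothness TYPE('a) s"
    unfolding modulus_of_smoothness_def
  proof (rule cSup_upper)
    \<comment> \<open>The estimate by \<open>L_const\<close> is uniform in \<open>x\<close> and
      \<open>y\<close>, so it also serves as the bound here.\<close>
    show "bdd_above {(norm (x + s *\<^sub>R y) + norm (x - s *\<^sub>R y)) / 2 - 1
        | x y :: 'a. x \<in> sphere 0 1 \<and> y \<in> sphere 0 1}"
    proof (rule bdd_aboveI, clarify)
      fix x y :: 'a
      assume "x \<in> sphere 0 1" "y \<in> sphere 0 1"
      then show "(norm (x + s *\<^sub>R y) + norm (x - s *\<^sub>R y)) / 2 - 1
          \<le> (2 * L_const TYPE('a) ((1 - s) / 2) - 1) / 2"
        using s by (intro mean_norm_le_L_const) auto
    qed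
  qed (use e in force)
  finally show ?thesis .
qed

text \<open>A unit vector ensures that the supremum defining the modulus is over a nonempty
  set.\<close>

lemma dim_ge_2_imp_unit_vector:
  assumes "dim_ge_2 TYPE('a::real_normed_vector)"
  obtains e :: "'a::real_normed_vector" where "norm e = 1"
proof -
  obtain B :: "'a set" where B: "independent B" "card B = 2"
    using assms by (auto simp: dim_ge_2_def)
  then obtain b where "b \<in> B" by fastforce
  with B have "b \<noteq> 0" using dependent_zero by blast
  then show thesis using that[of "sgn b"] by (simp add: norm_sgn)
qed

theorem theorem12:
  assumes "dim_ge_2 TYPE('a::banach)"
    and "((\<lambda>t. (2 * L_const TYPE('a) t - 1) / (1 - 2 * t)) \<longlongrightarrow> 0) (at_left (1/2))"
  shows "uniformly_smooth TYPE('a)"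
proof -
  obtain e :: 'a where e: "norm e = 1"
    using assms(1) by (rule dim_ge_2_imp_unit_vector)
  \<comment> \<open>The substitution \<open>t = (1 - s) / 2\<close> turns the left limit at 1/2 into
    a right limit at 0, and \<open>1 - 2 * t\<close> into \<open>s\<close>.\<close>
  have "filterlim (\<lambda>s::real. (1 - s) / 2) (at_left (1/2)) (at_right 0)"
    unfolding filterlim_at
    by (auto intro!: tendsto_eq_intros simp: eventually_at_filter)
  then have "((\<lambda>s. (2 * L_const TYPE('a) ((1 - s) / 2) - 1) / (1 - 2 * ((1 - s) / 2))) \<longlongrightarrow> 0)
      (at_right 0)"
    by (rule filterlim_compose[OF assms(2)])
  then have lim: "((\<lambda>s. (2 * L_const TYPE('a) ((1 - s) / 2) - 1) / s / 2) \<longlongrightarrow> 0) (at_right 0)"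
    by (intro tendsto_divide_zero) (simp add: field_simps)
  \<comment> \<open>On this interval both bounds on the modulus hold, and dividing by
    \<open>s > 0\<close> preserves them.\<close>
  have "\<forall>\<^sub>F s :: real in at_right 0. s \<in> {0<..<1}"
    by (rule eventually_at_right_real) simp
  then have "\<forall>\<^sub>F s in at_right 0. 0 \<le> modulus_of_smoothness TYPE('a) s / s"
    and "\<forall>\<^sub>F s in at_right 0. modulus_of_smoothness TYPE('a) s / s
      \<le> (2 * L_const TYPE('a) ((1 - s) / 2) - 1) / s / 2"
    using modulus_of_smoothness_nonneg[OF e] modulus_of_smoothness_le_L_const[OF e]
    by (auto elim!: eventually_mono simp: field_simps)
  then show ?thesis
    unfolding uniformly_smooth_def by (rule tendsto_sandwich[OF _ _ tendsto_const lim])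
qed

end
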